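(* Assume that $\Omega$ is nonempty and compact, that $\Omega\subseteq\Delta=[-1,1]^n$, and that $q_i(x)>0$ for all $x\in\Omega$ and all $i=1,\dots,m$. Let $\{\psi_k\}_{k\in\mathbb{N}}\subset\mathbb{R}[x]$ be a sequence of polynomials such that $\psi_k(x)\ge\tilde\psi(x)$ for all $x\in\Delta$ and all $k$, and $\lim_{k\to\infty}\int_\Delta|\psi_k(x)-\tilde\psi(x)|\,dx=0$. For $\delta>0$ and $k\in\mathbb{N}$ let $\mathcal{A}(\delta,k)=\{x\in\Omega:\psi_k(x)\le\delta\}$. Then for any $\delta>0$ we have $\mathcal{A}(\delta,k)\subset\mathcal{S}_w^{\delta}$ (for every $k$) and $$\mathrm{vol}(\{x\in\Omega:\psi(x)<\delta\})\le\lim_{k\to\infty}\mathrm{vol}(\mathcal{A}(\delta,k))\le\mathrm{vol}(\{x\in\Omega:\psi(x)\le\delta\})=\mathrm{vol}(\mathcal{S}_w^{\delta}).$$ Consequently, if $\mathrm{vol}(\{x\in\Omega:\psi(x)=\delta\})=0$, then $\lim_{k\to\infty}\mathrm{vol}(\mathcal{S}_w^{\delta}\setminus\mathcal{A}(\delta,k))=0$.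
   Context: Let $n,m,r\ge 1$, let $p_1,\dots,p_m,q_1,\dots,q_m,g_1,\dots,g_r\in\mathbb{R}[x]$ be real polynomials in $x=(x_1,\dots,x_n)$, let $\Omega=\{x\in\mathbb{R}^n: g_j(x)\ge 0,\ j=1,\dots,r\}$, and let $f=(f_1,\dots,f_m)$ with $f_i=p_i/q_i$. $\mathrm{vol}$ is Lebesgue measure on $\mathbb{R}^n$. For $\delta>0$, $\mathcal{S}_w^{\delta}$ is the set of weakly $(\delta,\dots,\delta)$-efficient points, i.e. the set of $x\in\Omega$ such that $f(y)-f(x)+(\delta,\dots,\delta)\notin-\mathbb{R}^m_{++}$ for all $y\in\Omega$, where $\mathbb{R}^m_{++}$ is the open positive orthant. The achievement function is $\psi(x)=\sup_{y\in\Omega}\min_{i=1,\dots,m}[f_i(x)-f_i(y)]$. Let $\Sigma^2[x]$ denote the set of sums of squares of real polynomials. For each $i$, $f_i^{\mathrm{lower}}$ and $f_i^{\mathrm{upper}}$ are fixed real numbers such that both $p_i-f_i^{\mathrm{lower}}q_i$ and $f_i^{\mathrm{upper}}q_i-p_i$ can be written in the form $\sigma_0+\sum_{j=1}^r\sigma_jg_j+\sum_{j=1}^n\sigma_{r+j}(1-x_j^2)$ with all $\sigma$'s in $\Sigma^2[x]$. Put $f^{\mathrm{lower}}=\min_if_i^{\mathrm{lower}}$ and $f^{\mathrm{upper}}=\max_if_i^{\mathrm{upper}}$, so that $f^{\mathrm{lower}}\le f_i\le f^{\mathrm{upper}}$ on $\Omega$ for all $i$. For $x\in\Delta$, let $\mathbf{K}_x$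 be the set of all $(y,z)\in\mathbb{R}^n\times\mathbb{R}$ such that $p_i(x)q_i(y)-p_i(y)q_i(x)-zq_i(x)q_i(y)\ge 0$ for $i=1,\dots,m$, $y\in\Omega$, and $z\in[f^{\mathrm{lower}}-f^{\mathrm{upper}},f^{\mathrm{upper}}-f^{\mathrm{lower}}]$; and $\tilde\psi(x)=\max_{(y,z)\in\mathbf{K}_x}z$. It is understood that $\mathbf{K}_x\ne\emptyset$ for every $x\in\Delta$, so that $\tilde\psi$ is a well-defined real-valued function on $\Delta$. *)

theory Defs
  imports "HOL-Analysis.Analysis"
begin

text \<open>
  The space \<open>\<real>\<^sup>n\<close> is \<^typ>\<open>real ^ 'n\<close>; the index sets of the objectives \<open>f\<^sub>i\<close> and of the
  constraints \<open>g\<^sub>j\<close> are the finite types \<open>'m\<close> and \<open>'r\<close>. Since \<open>\<real>\<close> is infinite, the ring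
  \<open>\<real>[x]\<close> is identified with the ring of polynomial functions on \<^typ>\<open>real ^ 'n\<close>, i.e. with
  \<^const>\<open>real_polynomial_function\<close>.
\<close>

definition feasible :: "('r::finite \<Rightarrow> real ^ 'n \<Rightarrow> real) \<Rightarrow> (real ^ 'n) set" where
  "feasible g = {x. \<forall>j. g j x \<ge> 0}"

definition unit_cube :: "(real ^ 'n) set" where
  "unit_cube = {x. \<forall>i. - 1 \<le> x $ i \<and> x $ i \<le> 1}"

definition objective ::
  "('m::finite \<Rightarrow> real ^ 'n \<Rightarrow> real) \<Rightarrow> ('m \<Rightarrow> real ^ 'n \<Rightarrow> real) \<Rightarrow> real ^ 'n \<Rightarrow> real ^ 'm" where
  "objective p q x = (\<chi> i. p i x / q i x)"

definition pos_orthant :: "(real ^ 'm) set" where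
  "pos_orthant = {v. \<forall>i. 0 < v $ i}"

definition weakly_efficient ::
  "(real ^ 'n \<Rightarrow> real ^ 'm) \<Rightarrow> (real ^ 'n) set \<Rightarrow> real ^ 'm \<Rightarrow> (real ^ 'n) set" where
  "weakly_efficient f \<Omega> \<epsilon> = {x \<in> \<Omega>. \<forall>y\<in>\<Omega>. f y - f x + \<epsilon> \<notin> uminus ` pos_orthant}"

definition achievement ::
  "(real ^ 'n \<Rightarrow> real ^ 'm::finite) \<Rightarrow> (real ^ 'n) set \<Rightarrow> real ^ 'n \<Rightarrow> real" where
  "achievement f \<Omega> x = (SUP y\<in>\<Omega>. MIN i. f x $ i - f y $ i)"

definition sum_of_squares :: "(real ^ 'n \<Rightarrow> real) set" where
  "sum_of_squares =
    {\<lambda>x. \<Sum>h\<leftarrow>hs. (h x)\<^sup>2 | hs. \<forall>h\<in>set hs. real_polynomial_function h}"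

text \<open>The \<open>\<sigma>\<^sub>r\<^sub>+\<^sub>j\<close>, which belong to the box constraints, are called \<open>\<tau> j\<close> here.\<close>

definition sos_certified ::
  "('r::finite \<Rightarrow> real ^ 'n \<Rightarrow> real) \<Rightarrow> (real ^ 'n \<Rightarrow> real) \<Rightarrow> bool" where
  "sos_certified g u \<longleftrightarrow>
    (\<exists>\<sigma>\<^sub>0 \<sigma> \<tau>. \<sigma>\<^sub>0 \<in> sum_of_squares \<and> (\<forall>j. \<sigma> j \<in> sum_of_squares) \<and> (\<forall>j. \<tau> j \<in> sum_of_squares) \<and>
      (\<forall>x. u x = \<sigma>\<^sub>0 x + (\<Sum>j\<in>UNIV. \<sigma> j x * g j x) + (\<Sum>j\<in>UNIV. \<tau> j x * (1 - (x $ j)\<^sup>2))))"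

text \<open>The parameters \<open>l\<close> and \<open>u\<close> stand for \<open>f\<^sup>l\<^sup>o\<^sup>w\<^sup>e\<^sup>r\<close> and \<open>f\<^sup>u\<^sup>p\<^sup>p\<^sup>e\<^sup>r\<close>.\<close>

definition K_set ::
  "('m::finite \<Rightarrow> real ^ 'n \<Rightarrow> real) \<Rightarrow> ('m \<Rightarrow> real ^ 'n \<Rightarrow> real) \<Rightarrow> (real ^ 'n) set \<Rightarrow>
    real \<Rightarrow> real \<Rightarrow> real ^ 'n \<Rightarrow> ((real ^ 'n) \<times> real) set" where
  "K_set p q \<Omega> l u x =
    {(y, z). (\<forall>i. p i x * q i y - p i y * q i x - z * q i x * q i y \<ge> 0) \<and>
      y \<in> \<Omega> \<and> z \<in> {l - u..u - l}}"

text \<open>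
  The maximum of \<open>z\<close> is attained as soon as the set is nonempty, \<open>\<Omega>\<close> is compact and the
  \<open>p\<^sub>i\<close>, \<open>q\<^sub>i\<close> are polynomials; otherwise \<^const>\<open>Greatest\<close> is unspecified.
\<close>

definition psi_tilde ::
  "('m::finite \<Rightarrow> real ^ 'n \<Rightarrow> real) \<Rightarrow> ('m \<Rightarrow> real ^ 'n \<Rightarrow> real) \<Rightarrow> (real ^ 'n) set \<Rightarrow>
    real \<Rightarrow> real \<Rightarrow> real ^ 'n \<Rightarrow> real" where
  "psi_tilde p q \<Omega> l u x = (GREATEST z. \<exists>y. (y, z) \<in> K_set p q \<Omega> l u x)"

definition sublevel :: "(real ^ 'n) set \<Rightarrow> (real ^ 'n \<Rightarrow> real) \<Rightarrow> real \<Rightarrow> (real ^ 'n) set" where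
  "sublevel \<Omega> h \<delta> = {x \<in> \<Omega>. h x \<le> \<delta>}"

abbreviation vol :: "(real ^ 'n) set \<Rightarrow> real" where
  "vol \<equiv> measure lebesgue"

end

theory Submission
  imports Defs
begin

text \<open>
  On \<open>\<Omega>\<close> the functions \<open>\<psi>\<close> and \<open>\<psi>~\<close> agree, and \<open>S = {\<psi> \<le> \<delta>}\<close>, which gives the inclusion.
  Convergence in \<open>L\<^sup>1\<close> implies convergence in measure, so \<open>A k\<close> asymptotically fills
  \<open>{\<psi> < \<delta>}\<close>. The rest of \<open>A k\<close> lies in \<open>{\<psi>\<^sub>k = \<delta>}\<close>, a null set unless the polynomial
  \<open>\<psi>\<^sub>k\<close> is the constant \<open>\<delta>\<close>. That happens only finitely often: a minimiser of one objective
  has \<open>\<psi> \<le> 0\<close>, hence \<open>\<psi>~\<close>, being upper semicontinuous, is not \<open>\<delta>\<close> almost everywhere. So the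
  limit exists and equals \<open>vol {\<psi> < \<delta>}\<close>.
\<close>

section \<open>Zero sets of nonzero polynomials are Lebesgue null\<close>

lemma continuous_on_real_polynomial_function:
  assumes "real_polynomial_function f"
  shows "continuous_on S f"
  using assms continuous_real_polymonial_function continuous_at_imp_continuous_on by blast

lemma finite_roots_real_polynomial_function:
  fixes f :: "real \<Rightarrow> real"
  assumes "real_polynomial_function f" and "f t \<noteq> 0"
  shows "finite {s. f s = 0}"
proof -
  obtain a n where f: "f = (\<lambda>x. \<Sum>i\<le>n. a i * x ^ i)"
    using assms(1) by (auto simp: real_polynomial_function_iff_sum)
  have "\<exists>i\<le>n. a i \<noteq> 0"
    using assms(2) unfolding f by (metis (no_types, lifting) atMost_iff mult_zero_left sum.neutral)
  then show ?thesis
    unfolding f by (simp add: polyfun_finite_roots)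
qed

text \<open>The tail unions decrease, and a point in all of them would lie in infinitely many
  \<open>K i\<close>, so their intersection is empty. The common bound \<open>B\<close> keeps the
  measures finite, which continuity from above requires.\<close>

lemma measure_tail_Union_tendsto_0:
  assumes K: "\<And>i::nat. K i \<in> sets M" and B: "B \<in> fmeasurable M" "\<And>i. K i \<subseteq> B"
    and fin: "\<And>x. finite {i. x \<in> K i}"
  shows "(\<lambda>n. measure M (\<Union>i\<in>{n..}. K i)) \<longlonglongrightarrow> 0"
proof -
  have "(\<lambda>n. measure M (\<Union>i\<in>{n..}. K i)) \<longlonglongrightarrow> measure M (\<Inter>n. \<Union>i\<in>{n..}. K i)"
  proof (rule Lim_measure_decseq)
    show "range (\<lambda>n. \<Union>i\<in>{n..}. K i) \<subseteq> sets M"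
      using K by auto
    show "decseq (\<lambda>n. \<Union>i\<in>{n..}. K i)"
      by (force simp: decseq_def)
    show "emeasure M (\<Union>i\<in>{n..}. K i) \<noteq> \<infinity>" for n
    proof -
      have "(\<Union>i\<in>{n..}. K i) \<in> fmeasurable M"
        using B K by (intro fmeasurableI2[OF B(1)]) auto
      then show ?thesis
        using fmeasurableD2 by fastforce
    qed
  qed
  moreover have "(\<Inter>n. \<Union>i\<in>{n..}. K i) = {}"
  proof -
    have "\<exists>n. x \<notin> (\<Union>i\<in>{n..}. K i)" for x
    proof -
      obtain n where "\<forall>i\<in>{i. x \<in> K i}. i < n"
        using fin[of x] finite_nat_set_iff_bounded by blast
      then show ?thesis
        by (intro exI[of _ n]) force
    qed
    then show ?thesis by blast
  qed
  ultimately show ?thesis by simp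
qed

text \<open>If a bounded piece \<open>K\<close> of the zero set had positive measure, the dilates
  \<open>s\<^sub>i K\<close> with \<open>s\<^sub>i = 1 - 1/(i+2)\<close> would have measures bounded away from \<open>0\<close>, although each point
  lies in only finitely many of them: a nonzero polynomial has finitely many zeros on a line through
  a point where it does not vanish.\<close>

lemma negligible_zeros_real_polynomial_function_0:
  fixes h :: "'a::euclidean_space \<Rightarrow> real"
  assumes h: "real_polynomial_function h" and h0: "h 0 \<noteq> 0"
  shows "negligible {x. h x = 0}"
proof -
  have "negligible (cball 0 (real R) \<inter> {x. h x = 0})" for R :: nat
  proof -
    define K where "K = cball 0 (real R) \<inter> {x. h x = 0}"
    \<comment> \<open>The offset 2 makes \<open>s 0 = 1 / 2\<close>. All factors lie between 1/2 and
      1, so the dilates stay in the ball and keep at least the share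
      \<open>(1 / 2) ^ DIM('a)\<close> of the measure of \<open>K\<close>.\<close>
    define s where "s i = 1 - 1 / (real i + 2)" for i :: nat
    \<comment> \<open>The summand 0 gives the dilation the affine shape that
      \<open>measure_lebesgue_affine\<close> rewrites.\<close>
    define E where "E i = (\<lambda>x. s i *\<^sub>R x + 0) ` K" for i
    have s: "1 / 2 \<le> s i" "s i \<le> 1" for i
      by (auto simp: s_def field_simps)
    have s_nz: "s i \<noteq> 0" for i
      using s(1)[of i] by auto
    have inj_s: "inj s"
      by (auto simp: inj_def s_def field_simps)
    have "closed {x. h x = 0}"
      using continuous_on_real_polynomial_function[OF h]
      by (intro closed_Collect_eq) auto
    then have K: "compact K"
      unfolding K_def by (intro compact_Int_closed compact_cball)
    have E: "compact (E i)" for i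
      unfolding E_def by (intro compact_continuous_image K continuous_intros)
    have sub: "E i \<subseteq> cball 0 (real R)" for i
    proof -
      have "s i * norm x \<le> real R" if "norm x \<le> real R" for x :: 'a
        using mult_mono[OF s(2)[of i] that] by simp
      then show ?thesis
        using s[of i] by (auto simp: E_def K_def)
    qed
    have fin: "finite {i. x \<in> E i}" for x
    proof -
      \<comment> \<open>If \<open>x\<close> lies in \<open>E i\<close>, then
        \<open>inverse (s i)\<close> is a root of the polynomial
        \<open>t \<mapsto> h (t *\<^sub>R x)\<close>, whose value at 0 is \<open>h 0\<close>, not 0.
        Distinct \<open>i\<close> give distinct roots, so only finitely many \<open>i\<close>
        occur.\<close>
      have "real_polynomial_function (h \<circ> (\<lambda>t. t *\<^sub>R x))"
        using h by (intro real_polynomial_function_compose polynomial_function_bounded_linear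
            bounded_linear_scaleR_left)
      then have "finite {t. (h \<circ> (\<lambda>t. t *\<^sub>R x)) t = 0}"
        by (rule finite_roots_real_polynomial_function[where t = 0]) (simp add: h0)
      then have "finite ((\<lambda>i. inverse (s i)) -` {t. (h \<circ> (\<lambda>t. t *\<^sub>R x)) t = 0})"
        (is "finite ?I")
        using inj_s by (intro finite_vimageI) (auto simp: inj_def)
      moreover have "{i. x \<in> E i} \<subseteq> ?I"
        by (auto simp: E_def K_def s_nz)
      ultimately show ?thesis
        by (rule rev_finite_subset)
    qed
    have lim: "(\<lambda>n. measure lebesgue (\<Union>i\<in>{n..}. E i)) \<longlonglongrightarrow> 0"
      using E sub fin
      by (intro measure_tail_Union_tendsto_0[where B = "cball 0 (real R)"])
         (auto intro: lmeasurable_compact fmeasurableD)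
    have "(1 / 2) ^ DIM('a) * measure lebesgue K \<le> measure lebesgue (\<Union>i\<in>{n..}. E i)" for n
    proof -
      have "(1 / 2) ^ DIM('a) * measure lebesgue K \<le> s n ^ DIM('a) * measure lebesgue K"
        using s[of n] by (intro mult_right_mono power_mono) auto
      also have "\<dots> = measure lebesgue (E n)"
        using s(1)[of n] unfolding E_def measure_lebesgue_affine by simp
      also have "\<dots> \<le> measure lebesgue (\<Union>i\<in>{n..}. E i)"
      proof (rule measure_mono_fmeasurable)
        have "E i \<in> sets lebesgue" for i
          using E[of i] by (simp add: fmeasurableD lmeasurable_compact)
        then show "(\<Union>i\<in>{n..}. E i) \<in> lmeasurable" "E n \<in> sets lebesgue"
          using sub by (auto intro!: fmeasurableI2[OF lmeasurable_cball[of 0 "real R"]])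
      qed auto
      finally show ?thesis .
    qed
    then have "(1 / 2) ^ DIM('a) * measure lebesgue K \<le> 0"
      using LIMSEQ_le_const[OF lim] by blast
    then have "measure lebesgue K = 0"
      using mult_le_cancel_left_pos[of "(1 / 2) ^ DIM('a)" "measure lebesgue K" 0]
      by (simp add: measure_le_0_iff)
    then show ?thesis
      using K by (simp add: K_def negligible_iff_measure0 lmeasurable_compact)
  qed
  then have "negligible (\<Union>R::nat. cball 0 (real R) \<inter> {x. h x = 0})"
    by (rule negligible_Union_nat)
  moreover have "(\<Union>R::nat. cball 0 (real R) \<inter> {x. h x = 0}) = {x. h x = 0}"
    by (auto simp: real_arch_simple)
  ultimately show ?thesis
    by simp
qed

text \<open>Translating by \<open>a\<close> moves a point where \<open>h\<close> does not vanish to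
  the origin; null sets are translation invariant.\<close>

lemma negligible_zeros_real_polynomial_function:
  fixes h :: "'a::euclidean_space \<Rightarrow> real"
  assumes h: "real_polynomial_function h" and a: "h a \<noteq> 0"
  shows "negligible {x. h x = 0}"
proof -
  have "polynomial_function (\<lambda>x::'a. a + x)"
    by (intro polynomial_function_add polynomial_function_const polynomial_function_id)
  then have "real_polynomial_function (h \<circ> (\<lambda>x. a + x))"
    using h by (rule real_polynomial_function_compose)
  then have "negligible {x. (h \<circ> (\<lambda>x. a + x)) x = 0}"
    by (rule negligible_zeros_real_polynomial_function_0) (simp add: a)
  then have "negligible ((+) a ` {x. h (a + x) = 0})"
    by (intro negligible_translation) simp
  moreover have "(+) a ` {x. h (a + x) = 0} = {x. h x = 0}"
    by (auto simp: image_iff intro!: exI[of _ "_ - a"])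
  ultimately show ?thesis by simp
qed

section \<open>From convergence in mean to sublevel sets\<close>

lemma measure_deviation_tendsto_0:
  fixes h :: "nat \<Rightarrow> 'a \<Rightarrow> real"
  assumes "\<And>k. integrable M (\<lambda>x. \<bar>h k x - F x\<bar>)"
    and lim: "(\<lambda>k. \<integral>x. \<bar>h k x - F x\<bar> \<partial>M) \<longlonglongrightarrow> 0" and "e > 0"
  shows "(\<lambda>k. measure M {x \<in> space M. e \<le> \<bar>h k x - F x\<bar>}) \<longlonglongrightarrow> 0"
proof (rule tendsto_sandwich[OF _ _ tendsto_const])
  show "(\<lambda>k. (\<integral>x. \<bar>h k x - F x\<bar> \<partial>M) / e) \<longlonglongrightarrow> 0"
    using tendsto_divide[OF lim tendsto_const[of e]] \<open>e > 0\<close> by simp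
  show "\<forall>\<^sub>F k in sequentially. measure M {x \<in> space M. e \<le> \<bar>h k x - F x\<bar>}
      \<le> (\<integral>x. \<bar>h k x - F x\<bar> \<partial>M) / e"
    using assms by (intro always_eventually allI
        integral_Markov_inequality_measure[where A = "{}"]) auto
qed auto

text \<open>Either \<open>F x\<close> lies in a thin band just below \<open>d\<close>, or
  \<open>h k x\<close> deviates from \<open>F x\<close> by at least the width of the band. The width
  is fixed first so that the band has small measure; then \<open>k\<close> is taken large.\<close>

lemma (in finite_measure) measure_sublevel_diff_tendsto_0:
  fixes h :: "nat \<Rightarrow> 'a \<Rightarrow> real"
  assumes [measurable]: "F \<in> borel_measurable M" "\<And>k. h k \<in> borel_measurable M"
    and dev: "\<And>e. e > 0 \<Longrightarrow>
      (\<lambda>k. measure M {x \<in> space M. e \<le> \<bar>h k x - F x\<bar>}) \<longlonglongrightarrow> 0"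
  shows "(\<lambda>k. measure M {x \<in> space M. F x < d \<and> d < h k x}) \<longlonglongrightarrow> 0"
proof (rule LIMSEQ_I)
  fix r :: real assume "0 < r"
  \<comment> \<open>The band leaves out the level \<open>F x = d\<close>, which may have positive
    measure; hence the bands shrink to the empty set.\<close>
  define B where "B n = {x \<in> space M. d - 1 / real (Suc n) < F x \<and> F x < d}" for n :: nat
  have B[measurable]: "B n \<in> sets M" for n
    unfolding B_def by measurable
  have "(\<lambda>n. measure M (B n)) \<longlonglongrightarrow> measure M (\<Inter>n. B n)"
  proof (rule finite_Lim_measure_decseq)
    have "1 / real (Suc n) \<le> 1 / real (Suc m)" if "m \<le> n" for m n
      using that by (simp add: field_simps)
    then show "decseq B"
      unfolding decseq_def B_def by (fastforce intro: order.strict_trans1)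
  qed auto
  moreover have "(\<Inter>n. B n) = {}"
  proof -
    have "\<exists>n. x \<notin> B n" for x
    proof (cases "F x < d")
      case True
      then obtain n where "inverse (real (Suc n)) < d - F x"
        using reals_Archimedean[of "d - F x"] by auto
      then show ?thesis
        by (intro exI[of _ n]) (auto simp: B_def inverse_eq_divide)
    qed (auto simp: B_def)
    then show ?thesis by blast
  qed
  ultimately have "(\<lambda>n. measure M (B n)) \<longlonglongrightarrow> 0" by simp
  from LIMSEQ_D[OF this, of "r / 2"] \<open>0 < r\<close> obtain n where n: "measure M (B n) < r / 2"
    by auto
  define e where "e = 1 / real (Suc n)"
  have "e > 0" by (simp add: e_def)
  from LIMSEQ_D[OF dev[OF this], of "r / 2"] \<open>0 < r\<close> obtain N
    where N: "\<And>k. k \<ge> N \<Longrightarrow> measure M {x \<in> space M. e \<le> \<bar>h k x - F x\<bar>} < r / 2"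
    by auto
  have "norm (measure M {x \<in> space M. F x < d \<and> d < h k x} - 0) < r" if "k \<ge> N" for k
  proof -
    have "measure M {x \<in> space M. F x < d \<and> d < h k x}
        \<le> measure M (B n \<union> {x \<in> space M. e \<le> \<bar>h k x - F x\<bar>})"
      by (rule finite_measure_mono) (auto simp: B_def e_def)
    also have "\<dots> \<le> measure M (B n) + measure M {x \<in> space M. e \<le> \<bar>h k x - F x\<bar>}"
      by (rule measure_Un_le) auto
    also have "\<dots> < r"
      using n N[OF that] by simp
    finally show ?thesis by simp
  qed
  then show "\<exists>N. \<forall>k\<ge>N. norm (measure M {x \<in> space M. F x < d \<and> d < h k x} - 0) < r"
    by blast
qed

section \<open>Positivity certificates and the cube\<close>

lemma sum_of_squares_nonneg: "s \<in> sum_of_squares \<Longrightarrow> 0 \<le> s x"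
  by (auto simp: sum_of_squares_def intro!: sum_list_nonneg)

lemma sos_certified_nonneg:
  assumes "sos_certified g u" "x \<in> feasible g" "x \<in> unit_cube"
  shows "0 \<le> u x"
proof -
  obtain s0 s t where st: "s0 \<in> sum_of_squares" "\<And>j. s j \<in> sum_of_squares"
      "\<And>j. t j \<in> sum_of_squares"
    and u: "u x = s0 x + (\<Sum>j\<in>UNIV. s j x * g j x) + (\<Sum>j\<in>UNIV. t j x * (1 - (x $ j)\<^sup>2))"
    using assms(1) unfolding sos_certified_def by blast
  have "0 \<le> 1 - (x $ j)\<^sup>2" for j
    using assms(3) by (simp add: unit_cube_def abs_square_le_1 abs_le_iff minus_le_iff)
  then show ?thesis
    unfolding u using st assms(2)
    by (intro add_nonneg_nonneg sum_nonneg mult_nonneg_nonneg)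
       (auto simp: sum_of_squares_nonneg feasible_def)
qed

lemma unit_cube_eq_cbox: "unit_cube = cbox (\<chi> i. - 1) (\<chi> i. 1)"
  by (auto simp: unit_cube_def mem_box_cart)

text \<open>A convex set with nonempty interior lies in the closure of that interior. This is for a
  minimiser on the boundary of the cube: every neighbourhood of it still meets the interior.\<close>

lemma unit_cube_subset_closure_interior: "unit_cube \<subseteq> closure (interior unit_cube)"
proof -
  have "(0 :: real ^ 'n) \<in> box (\<chi> i. - 1) (\<chi> i. 1)"
    by (simp add: mem_box_cart)
  then have "interior (unit_cube :: (real ^ 'n) set) \<noteq> {}"
    unfolding unit_cube_eq_cbox interior_cbox by blast
  then have "closure (interior (unit_cube :: (real ^ 'n) set)) = closure unit_cube"
    by (intro convex_closure_interior) (simp_all add: unit_cube_eq_cbox)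
  then show ?thesis
    using closure_subset by blast
qed

lemma unit_cube_lmeasurable: "unit_cube \<in> lmeasurable"
  by (simp add: unit_cube_eq_cbox)

section \<open>Attainment and upper semicontinuity of \<open>psi_tilde\<close>\<close>

text \<open>The graph of \<open>x \<mapsto> K_set p q \<Omega> l u x\<close> is cut out of a compact
  product by closed polynomial inequalities. The free interval \<open>{a..b}\<close> allows two
  uses: a single fibre for attainment, and the restriction \<open>c \<le> z\<close> for superlevel
  sets.\<close>

lemma compact_K_graph:
  fixes p q :: "'m::finite \<Rightarrow> real ^ 'n \<Rightarrow> real"
  assumes "\<And>i. real_polynomial_function (p i)" "\<And>i. real_polynomial_function (q i)"
    and "compact \<Omega>" and D: "compact D"
  shows "compact {w \<in> D \<times> \<Omega> \<times> {a..b}. snd w \<in> K_set p q \<Omega> l u (fst w)}"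
proof -
  have pc: "continuous_on S (\<lambda>w. p i (f w))" "continuous_on S (\<lambda>w. q i (f w))"
    if "continuous_on S f" for S i and f :: "(real ^ 'n) \<times> (real ^ 'n) \<times> real \<Rightarrow> real ^ 'n"
    using continuous_on_compose2[OF continuous_on_real_polynomial_function[OF assms(1)] that subset_UNIV]
      continuous_on_compose2[OF continuous_on_real_polynomial_function[OF assms(2)] that subset_UNIV]
    by this+
  define G where "G i = (\<lambda>w::(real ^ 'n) \<times> (real ^ 'n) \<times> real.
    p i (fst w) * q i (fst (snd w)) - p i (fst (snd w)) * q i (fst w)
      - snd (snd w) * q i (fst w) * q i (fst (snd w)))" for i
  have G: "closed {w. 0 \<le> G i w}" for i
    unfolding G_def by (intro closed_Collect_le continuous_intros pc)
  have "{w \<in> D \<times> \<Omega> \<times> {a..b}. snd w \<in> K_set p q \<Omega> l u (fst w)}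
      = (D \<times> \<Omega> \<times> ({a..b} \<inter> {l - u..u - l})) \<inter> (\<Inter>i. {w. 0 \<le> G i w})"
    by (auto simp: K_set_def G_def)
  moreover have "compact ((D \<times> \<Omega> \<times> ({a..b} \<inter> {l - u..u - l})) \<inter> (\<Inter>i. {w. 0 \<le> G i w}))"
    using assms(3) D G by (intro compact_Int_closed compact_Times closed_INT) auto
  ultimately show ?thesis by simp
qed

text \<open>The projection of the compact fibre over \<open>x\<close> to the \<open>z\<close> axis
  has a greatest element, so \<open>Greatest\<close> in \<open>psi_tilde\<close> is the intended
  maximum.\<close>

lemma psi_tilde_greatest:
  fixes p q :: "'m::finite \<Rightarrow> real ^ 'n \<Rightarrow> real"
  assumes "\<And>i. real_polynomial_function (p i)" "\<And>i. real_polynomial_function (q i)"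
    and "compact \<Omega>" and ne: "K_set p q \<Omega> l u x \<noteq> {}"
  shows "\<exists>y. (y, psi_tilde p q \<Omega> l u x) \<in> K_set p q \<Omega> l u x"
    and "(y, z) \<in> K_set p q \<Omega> l u x \<Longrightarrow> z \<le> psi_tilde p q \<Omega> l u x"
proof -
  define W where "W = {w \<in> {x} \<times> \<Omega> \<times> {l - u..u - l}. snd w \<in> K_set p q \<Omega> l u (fst w)}"
  have W: "compact ((\<lambda>w. snd (snd w)) ` W)"
    unfolding W_def using assms(1-3)
    by (intro compact_continuous_image compact_K_graph continuous_intros) auto
  have W_iff: "z \<in> (\<lambda>w. snd (snd w)) ` W \<longleftrightarrow> (\<exists>y. (y, z) \<in> K_set p q \<Omega> l u x)" for z
    by (force simp: W_def K_set_def image_iff)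
  have "(\<lambda>w. snd (snd w)) ` W \<noteq> {}"
    using ne W_iff by fastforce
  from compact_attains_sup[OF W this] obtain z0 y0
    where z0: "(y0, z0) \<in> K_set p q \<Omega> l u x"
      and max: "\<And>y z. (y, z) \<in> K_set p q \<Omega> l u x \<Longrightarrow> z \<le> z0"
    using W_iff by metis
  then have "psi_tilde p q \<Omega> l u x = z0"
    unfolding psi_tilde_def by (intro Greatest_equality) auto
  then show "\<exists>y. (y, psi_tilde p q \<Omega> l u x) \<in> K_set p q \<Omega> l u x"
    and "(y, z) \<in> K_set p q \<Omega> l u x \<Longrightarrow> z \<le> psi_tilde p q \<Omega> l u x"
    using z0 max by auto
qed

text \<open>The superlevel set is the projection to \<open>D\<close> of the compact part of the
  graph with \<open>c \<le> z\<close>; attainment of the maximum puts every point of the set into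
  this projection. The result serves both for measurability and for finding an open set where
  \<open>psi_tilde\<close> is small.\<close>

lemma closed_psi_tilde_superlevel:
  fixes p q :: "'m::finite \<Rightarrow> real ^ 'n \<Rightarrow> real"
  assumes poly: "\<And>i. real_polynomial_function (p i)" "\<And>i. real_polynomial_function (q i)"
    and "compact \<Omega>" and "compact D"
    and ne: "\<And>x. x \<in> D \<Longrightarrow> K_set p q \<Omega> l u x \<noteq> {}"
  shows "closed {x \<in> D. c \<le> psi_tilde p q \<Omega> l u x}"
proof -
  define W where "W = {w \<in> D \<times> \<Omega> \<times> {c..u - l}. snd w \<in> K_set p q \<Omega> l u (fst w)}"
  have "compact (fst ` W)"
    unfolding W_def using assms(1-4)
    by (intro compact_continuous_image compact_K_graph continuous_intros) auto
  moreover have "fst ` W = {x \<in> D. c \<le> psi_tilde p q \<Omega> l u x}"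
  proof (intro equalityI subsetI)
    fix x assume "x \<in> fst ` W"
    then obtain y z where "x \<in> D" "c \<le> z" and yz: "(y, z) \<in> K_set p q \<Omega> l u x"
      by (auto simp: W_def)
    moreover have "z \<le> psi_tilde p q \<Omega> l u x"
      using poly \<open>compact \<Omega>\<close> ne[OF \<open>x \<in> D\<close>] yz by (rule psi_tilde_greatest)
    ultimately show "x \<in> {x \<in> D. c \<le> psi_tilde p q \<Omega> l u x}"
      by auto
  next
    fix x assume x: "x \<in> {x \<in> D. c \<le> psi_tilde p q \<Omega> l u x}"
    then obtain y where y: "(y, psi_tilde p q \<Omega> l u x) \<in> K_set p q \<Omega> l u x"
      using psi_tilde_greatest(1)[OF poly \<open>compact \<Omega>\<close> ne] by blast
    then have "(x, y, psi_tilde p q \<Omega> l u x) \<in> W"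
      using x by (auto simp: W_def K_set_def)
    then show "x \<in> fst ` W"
      by force
  qed
  ultimately show ?thesis
    by (simp add: compact_imp_closed)
qed

section \<open>Agreement of \<open>psi_tilde\<close> and the achievement function on
  \<open>\<Omega>\<close>\<close>

lemma K_set_iff_objective:
  assumes "\<And>i. 0 < q i x" "\<And>i. 0 < q i y" "y \<in> \<Omega>"
  shows "(y, z) \<in> K_set p q \<Omega> l u x \<longleftrightarrow>
    (\<forall>i. z \<le> objective p q x $ i - objective p q y $ i) \<and> z \<in> {l - u..u - l}"
proof -
  have "0 \<le> p i x * q i y - p i y * q i x - z * q i x * q i y \<longleftrightarrow>
      z \<le> objective p q x $ i - objective p q y $ i" for i
    using assms(1,2)[of i] by (simp add: objective_def field_simps)
  then show ?thesis
    using assms(3) by (simp add: K_set_def)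
qed

text \<open>The bounds \<open>l\<close>, \<open>u\<close> on the objectives make the interval constraint of \<^const>\<open>K_set\<close> inactive.\<close>

lemma psi_tilde_eq_achievement:
  fixes p q :: "'m::finite \<Rightarrow> real ^ 'n \<Rightarrow> real"
  assumes "\<And>i. real_polynomial_function (p i)" "\<And>i. real_polynomial_function (q i)"
    and "compact \<Omega>" and q: "\<And>x i. x \<in> \<Omega> \<Longrightarrow> 0 < q i x"
    and bounds: "\<And>x i. x \<in> \<Omega> \<Longrightarrow> l \<le> objective p q x $ i \<and> objective p q x $ i \<le> u"
    and ne: "K_set p q \<Omega> l u x \<noteq> {}" and x: "x \<in> \<Omega>"
  shows "achievement (objective p q) \<Omega> x = psi_tilde p q \<Omega> l u x"
    and "achievement (objective p q) \<Omega> x \<le> c \<longleftrightarrow>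
      (\<forall>y\<in>\<Omega>. \<exists>i. objective p q x $ i - objective p q y $ i \<le> c)"
proof -
  note greatest = psi_tilde_greatest[OF assms(1-3) ne]
  \<comment> \<open>For \<open>y\<close> in \<open>\<Omega>\<close>, \<open>m y\<close> is the
    largest \<open>z\<close> with \<open>(y, z)\<close> in the constraint set, so both functions are
    the maximum of \<open>m\<close> over \<open>\<Omega>\<close>.\<close>
  define m where "m y = (MIN i. objective p q x $ i - objective p q y $ i)" for y
  have m_ge: "z \<le> m y \<longleftrightarrow> (\<forall>i. z \<le> objective p q x $ i - objective p q y $ i)" for y z
    by (simp add: m_def)
  have m_le: "m y \<le> z \<longleftrightarrow> (\<exists>i. objective p q x $ i - objective p q y $ i \<le> z)" for y z
    by (simp add: m_def Min_le_iff)
  have "l - u \<le> objective p q x $ i - objective p q y $ i"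
    "objective p q x $ i - objective p q y $ i \<le> u - l" if "y \<in> \<Omega>" for y i
    using bounds[OF x, of i] bounds[OF that, of i] by auto
  then have m_range: "m y \<in> {l - u..u - l}" if "y \<in> \<Omega>" for y
    using that by (auto simp: m_ge m_le)
  have "(y, m y) \<in> K_set p q \<Omega> l u x" if "y \<in> \<Omega>" for y
    using q[OF x] q[OF that] that m_range[OF that] m_ge[of "m y" y]
    by (subst K_set_iff_objective) auto
  then have upper: "m y \<le> psi_tilde p q \<Omega> l u x" if "y \<in> \<Omega>" for y
    using that greatest(2) by blast
  obtain y0 where y0: "(y0, psi_tilde p q \<Omega> l u x) \<in> K_set p q \<Omega> l u x"
    using greatest(1) by blast
  then have "y0 \<in> \<Omega>"
    by (simp add: K_set_def)
  then have "psi_tilde p q \<Omega> l u x \<le> m y0"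
    using y0 q[OF x] q[OF \<open>y0 \<in> \<Omega>\<close>] by (subst (asm) K_set_iff_objective) (auto simp: m_ge)
  then have attained: "m y0 = psi_tilde p q \<Omega> l u x"
    using upper[OF \<open>y0 \<in> \<Omega>\<close>] by simp
  then show eq: "achievement (objective p q) \<Omega> x = psi_tilde p q \<Omega> l u x"
    unfolding achievement_def m_def[symmetric]
    using upper attained[symmetric] \<open>y0 \<in> \<Omega>\<close> by (intro cSup_eq_maximum) auto
  show "achievement (objective p q) \<Omega> x \<le> c \<longleftrightarrow>
      (\<forall>y\<in>\<Omega>. \<exists>i. objective p q x $ i - objective p q y $ i \<le> c)"
    unfolding eq m_le[symmetric] using upper attained \<open>y0 \<in> \<Omega>\<close> by force
qed

text \<open>A vector lies outside the negative open orthant iff some coordinate is nonnegative. The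
  resulting condition is the one that \<open>psi_tilde_eq_achievement\<close> identifies with a
  sublevel set of the achievement function.\<close>

lemma weakly_efficient_iff:
  "x \<in> weakly_efficient f \<Omega> (\<chi> i. d) \<longleftrightarrow> x \<in> \<Omega> \<and> (\<forall>y\<in>\<Omega>. \<exists>i. f x $ i - f y $ i \<le> d)"
proof -
  have "v \<in> uminus ` pos_orthant \<longleftrightarrow> (\<forall>i. v $ i < 0)" for v :: "real ^ 'b"
    unfolding pos_orthant_def image_iff by (auto intro: exI[of _ "- v"])
  then have "f y - f x + (\<chi> i. d) \<notin> uminus ` pos_orthant \<longleftrightarrow> (\<exists>i. f x $ i - f y $ i \<le> d)" for y
    by (simp add: not_less algebra_simps)
  then show ?thesis
    by (simp add: weakly_efficient_def)
qed

theorem theorem4p1: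
  fixes p q :: "'m::finite \<Rightarrow> real ^ 'n::finite \<Rightarrow> real"
    and g :: "'r::finite \<Rightarrow> real ^ 'n \<Rightarrow> real"
    and f_lower f_upper :: "'m \<Rightarrow> real"
    and psi_seq :: "nat \<Rightarrow> real ^ 'n \<Rightarrow> real"
    and \<delta> :: real
  defines "\<Omega> \<equiv> feasible g"
    and "\<psi> \<equiv> achievement (objective p q) (feasible g)"
    and "\<psi>t \<equiv> psi_tilde p q (feasible g) (Min (range f_lower)) (Max (range f_upper))"
    and "S \<equiv> weakly_efficient (objective p q) (feasible g) (\<chi> i. \<delta>)"
    and "A \<equiv> (\<lambda>k. sublevel (feasible g) (psi_seq k) \<delta>)"
  assumes poly_p: "\<And>i. real_polynomial_function (p i)"
    and poly_q: "\<And>i. real_polynomial_function (q i)"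
    and poly_g: "\<And>j. real_polynomial_function (g j)"
    and lower: "\<And>i. sos_certified g (\<lambda>x. p i x - f_lower i * q i x)"
    and upper: "\<And>i. sos_certified g (\<lambda>x. f_upper i * q i x - p i x)"
    and K_nonempty: "\<And>x. x \<in> unit_cube \<Longrightarrow>
      K_set p q \<Omega> (Min (range f_lower)) (Max (range f_upper)) x \<noteq> {}"
    and Omega_nonempty: "\<Omega> \<noteq> {}"
    and Omega_compact: "compact \<Omega>"
    and Omega_cube: "\<Omega> \<subseteq> unit_cube"
    and q_pos: "\<And>x i. x \<in> \<Omega> \<Longrightarrow> q i x > 0"
    and poly_psi: "\<And>k. real_polynomial_function (psi_seq k)"
    and psi_above: "\<And>k x. x \<in> unit_cube \<Longrightarrow> psi_seq k x \<ge> \<psi>t x"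
    and psi_L1: "(\<lambda>k. LINT x:unit_cube|lebesgue. \<bar>psi_seq k x - \<psi>t x\<bar>) \<longlonglongrightarrow> 0"
    and delta_pos: "\<delta> > 0"
  shows "(\<forall>k. A k \<subseteq> S) \<and>
    convergent (\<lambda>k. vol (A k)) \<and>
    vol {x \<in> \<Omega>. \<psi> x < \<delta>} \<le> lim (\<lambda>k. vol (A k)) \<and>
    lim (\<lambda>k. vol (A k)) \<le> vol {x \<in> \<Omega>. \<psi> x \<le> \<delta>} \<and>
    vol {x \<in> \<Omega>. \<psi> x \<le> \<delta>} = vol S \<and>
    (vol {x \<in> \<Omega>. \<psi> x = \<delta>} = 0 \<longrightarrow> (\<lambda>k. vol (S - A k)) \<longlonglongrightarrow> 0)"
proof -

  \<comment> \<open>Bounds on the objectives, and the inclusion of \<open>A k\<close> in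
    \<open>S\<close>\<close>
  define l where "l = Min (range f_lower)"
  define u where "u = Max (range f_upper)"
  define F where "F = \<psi>t"
  have F: "F = psi_tilde p q \<Omega> l u"
    unfolding F_def \<psi>t_def \<Omega>_def l_def u_def ..
  have bounds: "l \<le> objective p q x $ i \<and> objective p q x $ i \<le> u" if "x \<in> \<Omega>" for x i
  proof -
    have "x \<in> feasible g" "x \<in> unit_cube" "0 < q i x"
      using that Omega_cube q_pos \<Omega>_def by auto
    then have "f_lower i \<le> p i x / q i x" "p i x / q i x \<le> f_upper i"
      using sos_certified_nonneg[OF lower[of i]] sos_certified_nonneg[OF upper[of i]]
      by (auto simp: field_simps)
    moreover have "l \<le> f_lower i" "f_upper i \<le> u"
      by (simp_all add: l_def u_def)
    ultimately show ?thesis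
      by (simp add: objective_def)
  qed
  have ne: "K_set p q \<Omega> l u x \<noteq> {}" if "x \<in> unit_cube" for x
    using K_nonempty[OF that] by (simp add: l_def u_def)
  have ne': "K_set p q \<Omega> l u x \<noteq> {}" if "x \<in> \<Omega>" for x
    using ne Omega_cube that by blast
  note greatest = psi_tilde_greatest[OF poly_p poly_q Omega_compact ne]
  note achieve = psi_tilde_eq_achievement[OF poly_p poly_q Omega_compact q_pos bounds ne']
  have psi_F: "\<psi> x = F x" if "x \<in> \<Omega>" for x
    using achieve(1)[OF _ _ that that] by (simp add: \<psi>_def F \<Omega>_def)
  have psi_le_iff: "\<psi> x \<le> c \<longleftrightarrow>
      (\<forall>y\<in>\<Omega>. \<exists>i. objective p q x $ i - objective p q y $ i \<le> c)"
    if "x \<in> \<Omega>" for x c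
    using achieve(2)[OF _ _ that that] by (simp add: \<psi>_def F \<Omega>_def)
  have S_eq: "{x \<in> \<Omega>. \<psi> x \<le> \<delta>} = S"
    using psi_le_iff by (auto simp: S_def weakly_efficient_iff \<Omega>_def)
  have A_sub: "A k \<subseteq> S" for k
  proof
    fix x assume "x \<in> A k"
    then have "x \<in> \<Omega>" "psi_seq k x \<le> \<delta>"
      by (simp_all add: A_def sublevel_def \<Omega>_def)
    then show "x \<in> S"
      using psi_above[of x k] Omega_cube psi_F[of x] by (auto simp: S_eq[symmetric] F_def)
  qed

  \<comment> \<open>Convergence in measure on the cube\<close>
  define N :: "(real ^ 'n) measure" where "N = restrict_space lebesgue unit_cube"
  have cube[simp]: "unit_cube \<in> sets lebesgue"
    using unit_cube_lmeasurable by (rule fmeasurableD)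
  have space_N: "space N = unit_cube"
    by (simp add: N_def space_restrict_space)
  have sets_N: "X \<in> sets N \<longleftrightarrow> X \<subseteq> unit_cube \<and> X \<in> sets lebesgue" for X
    unfolding N_def by (auto simp: sets_restrict_space_iff)
  have measure_N: "measure N X = vol X" if "X \<subseteq> unit_cube" for X
    unfolding N_def using that by (intro measure_restrict_space) auto
  interpret N: finite_measure N
    using unit_cube_lmeasurable
    by (intro finite_measureI)
      (simp add: space_N[unfolded N_def] N_def emeasure_restrict_space fmeasurable_def less_top)
  have closed_F: "closed {x \<in> unit_cube. c \<le> F x}" for c
    unfolding F by (intro closed_psi_tilde_superlevel poly_p poly_q Omega_compact ne)
      (simp_all add: unit_cube_eq_cbox)
  have F_meas[measurable]: "F \<in> borel_measurable N"
    unfolding borel_measurable_iff_ge space_N sets_N using closed_F by auto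
  have cont: "continuous_on UNIV (psi_seq k)" for k
    by (intro continuous_on_real_polynomial_function poly_psi)
  have h_meas[measurable]: "psi_seq k \<in> borel_measurable N" for k
    using borel_measurable_continuous_onI[OF cont[of k]] unfolding N_def
    by (intro measurable_restrict_space1 measurable_completion) simp
  have F_range: "F x \<in> {l - u..u - l}" if "x \<in> unit_cube" for x
    using greatest(1)[OF that] by (auto simp: F K_set_def)
  \<comment> \<open>The Bochner integral of a nonintegrable function is 0 by convention, so
    \<open>psi_L1\<close> carries information only once integrability is known. Both functions are
    bounded on the cube.\<close>
  have integrable: "integrable N (\<lambda>x. \<bar>psi_seq k x - F x\<bar>)" for k
  proof -
    have "compact (unit_cube :: (real ^ 'n) set)"
      by (simp add: unit_cube_eq_cbox)
    then have "compact (psi_seq k ` unit_cube)"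
      by (intro compact_continuous_image continuous_on_subset[OF cont]) auto
    then obtain b where b: "\<And>x. x \<in> unit_cube \<Longrightarrow> \<bar>psi_seq k x\<bar> \<le> b"
      using compact_imp_bounded by (force simp: bounded_real)
    have "AE x in N. norm \<bar>psi_seq k x - F x\<bar> \<le> b + (u - l)"
      using b F_range by (intro AE_I2) (force simp: space_N abs_le_iff)
    then show ?thesis
      by (intro N.integrable_const_bound) auto
  qed
  have integral: "(LINT x:unit_cube|lebesgue. \<bar>psi_seq k x - F x\<bar>)
      = (\<integral>x. \<bar>psi_seq k x - F x\<bar> \<partial>N)" for k
    unfolding N_def set_lebesgue_integral_def by (subst integral_restrict_space) auto
  have dev: "(\<lambda>k. measure N {x \<in> space N. e \<le> \<bar>psi_seq k x - F x\<bar>}) \<longlonglongrightarrow> 0"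
    if "e > 0" for e
    using psi_L1 integrable that unfolding F_def[symmetric] integral
    by (intro measure_deviation_tendsto_0)

  \<comment> \<open>The sets \<open>A k\<close> asymptotically fill \<open>B\<close>\<close>
  define B where "B = {x \<in> \<Omega>. F x < \<delta>}"
  have Omega_meas: "\<Omega> \<in> lmeasurable"
    using Omega_compact by (rule lmeasurable_compact)
  have sublevel_meas: "{x \<in> \<Omega>. f x < c} \<in> lmeasurable" "{x \<in> \<Omega>. f x \<le> c} \<in> lmeasurable"
    if [measurable]: "f \<in> borel_measurable N" for f :: "real ^ 'n \<Rightarrow> real" and c
  proof -
    have "{x \<in> space N. f x < c} \<in> sets N" "{x \<in> space N. f x \<le> c} \<in> sets N"
      by measurable
    then have "\<Omega> \<inter> {x \<in> unit_cube. f x < c} \<in> lmeasurable"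
      "\<Omega> \<inter> {x \<in> unit_cube. f x \<le> c} \<in> lmeasurable"
      using Omega_meas by (auto simp: sets_N space_N intro!: fmeasurable_Int_fmeasurable)
    moreover have "\<Omega> \<inter> {x \<in> unit_cube. f x < c} = {x \<in> \<Omega>. f x < c}"
      "\<Omega> \<inter> {x \<in> unit_cube. f x \<le> c} = {x \<in> \<Omega>. f x \<le> c}"
      using Omega_cube by auto
    ultimately show "{x \<in> \<Omega>. f x < c} \<in> lmeasurable" "{x \<in> \<Omega>. f x \<le> c} \<in> lmeasurable"
      by simp_all
  qed
  have B_meas: "B \<in> lmeasurable"
    unfolding B_def by (rule sublevel_meas) simp
  have A_eq: "A k = {x \<in> \<Omega>. psi_seq k x \<le> \<delta>}" for k
    by (simp add: A_def sublevel_def \<Omega>_def)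
  have A_meas: "A k \<in> lmeasurable" for k
    unfolding A_eq by (rule sublevel_meas) simp
  have S_eq_F: "S = {x \<in> \<Omega>. F x \<le> \<delta>}"
    using psi_F by (auto simp: S_eq[symmetric])
  have S_meas: "S \<in> lmeasurable"
    unfolding S_eq_F by (rule sublevel_meas) simp

  have BA: "(\<lambda>k. vol (B - A k)) \<longlonglongrightarrow> 0"
  proof (rule tendsto_sandwich[OF _ _ tendsto_const])
    show "(\<lambda>k. measure N {x \<in> space N. F x < \<delta> \<and> \<delta> < psi_seq k x}) \<longlonglongrightarrow> 0"
      using dev by (intro N.measure_sublevel_diff_tendsto_0) auto
    have "vol (B - A k) \<le> measure N {x \<in> space N. F x < \<delta> \<and> \<delta> < psi_seq k x}" for k
    proof -
      have "B - A k \<subseteq> {x \<in> space N. F x < \<delta> \<and> \<delta> < psi_seq k x}"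
        using Omega_cube by (auto simp: B_def A_eq space_N)
      then have "measure N (B - A k) \<le> measure N {x \<in> space N. F x < \<delta> \<and> \<delta> < psi_seq k x}"
        by (rule N.finite_measure_mono) measurable
      moreover have "measure N (B - A k) = vol (B - A k)"
        using Omega_cube by (intro measure_N) (auto simp: B_def)
      ultimately show ?thesis by simp
    qed
    then show "\<forall>\<^sub>F k in sequentially. vol (B - A k)
        \<le> measure N {x \<in> space N. F x < \<delta> \<and> \<delta> < psi_seq k x}"
      by simp
  qed auto

  \<comment> \<open>Eventually \<open>psi_seq k\<close> is not the constant
    \<open>\<delta>\<close>\<close>
  have not_const: "\<forall>\<^sub>F k in sequentially. \<exists>a. psi_seq k a \<noteq> \<delta>"
  proof -
    \<comment> \<open>Any one objective will do: at its minimiser, its difference to every other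
      value is at most 0, and so is the minimum over all indices.\<close>
    obtain i :: 'm where True by simp
    have "continuous_on \<Omega> (\<lambda>x. objective p q x $ i)"
      unfolding objective_def vec_lambda_beta
      by (intro continuous_on_divide continuous_on_real_polynomial_function poly_p poly_q ballI)
        (rule less_imp_neq[OF q_pos, symmetric])
    from continuous_attains_inf[OF Omega_compact Omega_nonempty this]
    obtain x0 where x0: "x0 \<in> \<Omega>"
      and min: "\<And>y. y \<in> \<Omega> \<Longrightarrow> objective p q x0 $ i \<le> objective p q y $ i"
      by blast
    have "\<psi> x0 \<le> 0"
      unfolding psi_le_iff[OF x0] using min by (auto intro!: exI[of _ i])
    then have Fx0: "F x0 \<le> 0"
      using psi_F[OF x0] by simp
    \<comment> \<open>If \<open>psi_seq k\<close> were the constant \<open>\<delta>\<close>, it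
      would differ from \<open>F\<close> by more than \<open>\<delta> / 2\<close> on all of
      \<open>U\<close>. This open nonempty set has positive volume independent of \<open>k\<close>,
      against convergence in measure.\<close>
    define U where "U = interior unit_cube - {x \<in> unit_cube. \<delta> / 2 \<le> F x}"
    have "open U"
      unfolding U_def by (intro open_Diff open_interior closed_F)
    have "U \<noteq> {}"
    proof -
      have "x0 \<in> closure (interior unit_cube)"
        using x0 Omega_cube unit_cube_subset_closure_interior by blast
      moreover have "open (- {x \<in> unit_cube. \<delta> / 2 \<le> F x})"
        by (intro open_Compl closed_F)
      moreover have "x0 \<in> - {x \<in> unit_cube. \<delta> / 2 \<le> F x}"
        using Fx0 delta_pos by auto
      ultimately show ?thesis
        unfolding U_def closure_iff_nhds_not_empty by blast
    qed
    have U_sub: "U \<subseteq> unit_cube"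
      using interior_subset by (auto simp: U_def)
    have "U \<in> lmeasurable"
      using \<open>open U\<close> bounded_subset[OF _ U_sub]
      by (intro lmeasurable_open) (simp_all add: unit_cube_eq_cbox)
    then have "0 < vol U"
      using open_not_negligible[OF \<open>open U\<close> \<open>U \<noteq> {}\<close>]
      by (simp add: negligible_iff_measure0 zero_less_measure_iff)
    from order_tendstoD(2)[OF dev[of "\<delta> / 2"] this] delta_pos
    have "\<forall>\<^sub>F k in sequentially.
        measure N {x \<in> space N. \<delta> / 2 \<le> \<bar>psi_seq k x - F x\<bar>} < vol U"
      by simp
    then show ?thesis
    proof (rule eventually_mono)
      fix k
      assume less: "measure N {x \<in> space N. \<delta> / 2 \<le> \<bar>psi_seq k x - F x\<bar>} < vol U"
      show "\<exists>a. psi_seq k a \<noteq> \<delta>"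
      proof (rule ccontr)
        assume const: "\<not> ?thesis"
        have "U \<subseteq> {x \<in> space N. \<delta> / 2 \<le> \<bar>psi_seq k x - F x\<bar>}"
        proof
          fix x assume "x \<in> U"
          then have "x \<in> unit_cube" "F x < \<delta> / 2"
            using U_sub by (auto simp: U_def)
          then show "x \<in> {x \<in> space N. \<delta> / 2 \<le> \<bar>psi_seq k x - F x\<bar>}"
            using const abs_ge_self[of "\<delta> - F x"] by (simp add: space_N)
        qed
        then have "measure N U \<le> measure N {x \<in> space N. \<delta> / 2 \<le> \<bar>psi_seq k x - F x\<bar>}"
          by (rule N.finite_measure_mono) measurable
        then show False
          using less measure_N[OF U_sub] by simp
      qed
    qed
  qed

  \<comment> \<open>The limit of the volumes\<close>
  have vol_diff: "vol (X - Y) = vol X - vol (X \<inter> Y)"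
    if "X \<in> lmeasurable" "Y \<in> lmeasurable" for X Y :: "(real ^ 'n) set"
    using measurable_measure_Diff[OF that(1), of "X \<inter> Y"] that
    by (simp add: fmeasurableD sets.Int Diff_Int)
  have "\<forall>\<^sub>F k in sequentially. vol B - vol (B - A k) = vol (A k)"
    using not_const
  proof (rule eventually_mono)
    fix k assume "\<exists>a. psi_seq k a \<noteq> \<delta>"
    then obtain a where "psi_seq k a - \<delta> \<noteq> 0"
      by auto
    then have "negligible {x. psi_seq k x - \<delta> = 0}"
      by (intro negligible_zeros_real_polynomial_function[where h = "\<lambda>x. psi_seq k x - \<delta>"]
          real_polynomial_function_diff poly_psi real_polynomial_function.intros)
    \<comment> \<open>Outside \<open>B\<close>, a point of \<open>A k\<close> satisfies
      \<open>\<delta> \<le> F x \<le> psi_seq k x \<le> \<delta>\<close>, so equality holds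
      throughout.\<close>
    moreover have "A k - B \<subseteq> {x. psi_seq k x - \<delta> = 0}"
    proof
      fix x assume x: "x \<in> A k - B"
      then have "F x \<le> psi_seq k x"
        using Omega_cube psi_above[of x k] by (auto simp: A_eq F_def)
      then show "x \<in> {x. psi_seq k x - \<delta> = 0}"
        using x by (auto simp: A_eq B_def)
    qed
    ultimately have "negligible (A k - B)"
      by (rule negligible_subset)
    then have "vol (A k) - vol (A k \<inter> B) = 0"
      using vol_diff[OF A_meas[of k] B_meas] by (simp add: negligible_imp_measure0)
    moreover have "vol (B - A k) = vol B - vol (A k \<inter> B)"
      using vol_diff[OF B_meas A_meas[of k]] by (simp add: Int_commute)
    ultimately show "vol B - vol (B - A k) = vol (A k)"
      by simp
  qed
  then have vol_A: "(\<lambda>k. vol (A k)) \<longlonglongrightarrow> vol B"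
    using tendsto_diff[OF tendsto_const BA, of "vol B"] by (auto intro: Lim_transform_eventually)
  have B_eq: "B = {x \<in> \<Omega>. \<psi> x < \<delta>}"
    using psi_F by (auto simp: B_def)
  have "B \<subseteq> S"
    by (auto simp: B_def S_eq_F)
  then have "vol B \<le> vol S"
    using B_meas S_meas by (intro measure_mono_fmeasurable) (auto intro: fmeasurableD)
  moreover have "(\<lambda>k. vol (S - A k)) \<longlonglongrightarrow> 0" if null: "vol {x \<in> \<Omega>. \<psi> x = \<delta>} = 0"
  proof (rule tendsto_sandwich[OF _ _ tendsto_const BA])
    \<comment> \<open>Passing from \<open>B\<close> to \<open>S\<close> adds only the level set of
      \<open>\<delta>\<close>. If that is null, \<open>vol (S - A k)\<close> is controlled by
      \<open>vol (B - A k)\<close>, which tends to 0 by \<open>BA\<close>.\<close>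
    have diff: "{x \<in> \<Omega>. \<psi> x = \<delta>} = S - B"
      unfolding S_eq[symmetric] B_eq by auto
    have "vol (S - A k) \<le> vol (B - A k)" for k
    proof -
      have "vol (S - A k) \<le> vol ((B - A k) \<union> (S - B))"
        using A_meas B_meas S_meas
        by (intro measure_mono_fmeasurable fmeasurable.Un fmeasurable.Diff)
           (auto intro: fmeasurableD fmeasurable.Diff)
      also have "\<dots> \<le> vol (B - A k) + vol (S - B)"
        using A_meas B_meas S_meas
        by (intro measure_Un_le) (auto intro: fmeasurableD)
      finally show ?thesis
        using null diff by simp
    qed
    then show "\<forall>\<^sub>F k in sequentially. vol (S - A k) \<le> vol (B - A k)"
      by simp
  qed auto
  ultimately show ?thesis
    using A_sub S_eq B_eq limI[OF vol_A] convergentI[OF vol_A] by auto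
qed

end
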